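(* Let $K\subseteq\{0,1\}^n$ be a totally-ordered multiple knapsack set whose set of minimal covers is $$\big\{\{1,\ldots,p-1,p+1,\ldots,q\}\big\}\cup\big\{\{1,\ldots,p,i\}\ :\ i=p+1,\ldots,q\big\}$$ for some $p=1,\ldots,q-2$, $q\le n$. Then $\operatorname{conv}(K)$ can be described by the bound constraints $0\le x_i\le1$ for $i\in[n]$, the cover inequalities $$\sum_{i=1}^px_i+x_j\le p\quad(j=p+1,\ldots,q),\qquad \sum_{i=1}^{p-1}x_i+\sum_{i=p+1}^qx_i\le q-2,$$ and one multi-cover inequality (MCI): $$(q-p)\sum_{i=1}^{p-1}x_i+(q-p-1)x_p+\sum_{i=p+1}^qx_i\le p(q-p)-1.$$
   Context: Notation: $[n]=\{1,\ldots,n\}$; for a vector $\alpha\in\mathbb{R}^n$ and $S\subseteq[n]$, $\alpha(S)=\sum_{i\in S}\alpha_i$. Totally-ordered multiple knapsack set (TOMKS): a set $K=\{x\in\{0,1\}^n\mid Ax\le b\}$ where $A\in\mathbb{Z}_+^{m\times n}$, $b\in\mathbb{Z}_+^m$ (nonnegative integer entries), and the columns of $A$ form a chain in the componentwise order, indexed so that $A_{\cdot1}\ge A_{\cdot2}\ge\cdots\ge A_{\cdot n}$. A set $S\subseteq[n]$ is a cover for $K$ if its incidence vector is not in $K$; it is a minimal cover if no proper subset of it is a cover. The cover inequality of a cover $S$ is $\sum_{i\in S}x_i\le|S|-1$. Dominance: for $S_1,S_2\subseteq[n]$, $S_1\triangleright S_2$ means there is an injective function $f:S_2\to S_1$ with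 $f(i)\le i$ for all $i\in S_2$. Given a family $\mathscr{C}=\{C_1,\ldots,C_k\}$ of covers for $K$, let $C_0=\bigcap_{h=1}^kC_h$, $C=\bigcup_{h=1}^kC_h$, $\bar C_h=C\setminus C_h$. The discrepancy family is $\mathcal{D}(\mathscr{C})=\{C_1\setminus C_0,\ldots,C_k\setminus C_0\}$. The family $\mathscr{C}$ is a multi-cover for $K$ if for every $T\subseteq\bigcup_{D\in\mathcal{D}(\mathscr{C})}D$ with $T\notin\mathcal{D}(\mathscr{C})$ there is $D'\in\mathcal{D}(\mathscr{C})$ with $T\triangleright D'$ or $D'\triangleright T$. Multi-cover inequality (MCI): given a multi-cover $\{C_1,\ldots,C_k\}$, write $C\setminus C_0=\{i_1<\cdots<i_r\}$. An MCI associated with the multi-cover is any inequality $\alpha^Tx\le\beta$ produced as follows (a maximum or minimum over an empty set is taken to be $0$): $\alpha_i=0$ for $i\notin C$; $\alpha_{i_r}=1$; successively for $t=r-1,\ldots,1$, $\alpha_{i_t}$ is any integer with $$\alpha_{i_t}\ge \Big(\max_{h\in[k]:\,i_t\in C_h}\ \max_{\ell\in\bar C_h:\,\ell>i_t}\alpha_\ell\Big)+1;$$ then for each $j\in C_0$, $\alpha_j$ is any integer with $$\alpha_j\ge\min_{h\in[k]}\max\Big\{\max_{\ell<j,\ \ell\in\bar C_h}\alpha_\ell,\ \sum_{\ell>j,\ \ell\in\bar C_h}\alpha_\ell+1\Big\};$$ finally $\beta=\max_{h\in[k]}\alpha(C_h)-1$.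
   Formalization: The last inequality is asserted to be an MCI only for q ≥ p+3; for q = p+2 it is never an MCI under the given definition (e.g. K: x_1+x_2+x_3 ≤ 1, p=1, q=3). The description of conv(K) is asserted for all p ≤ q−2. *)

theory Defs
  imports "HOL-Analysis.Analysis"
begin

text \<open>
  Vectors of $R^n$ live in \<open>real ^ 'n\<close> with \<open>CARD('n) = n\<close>. The parameter \<open>e\<close> below is a bijection
  from \<open>{1..n}\<close> to the index type \<open>'n\<close>; it fixes the numbering of the coordinates, so that
  \<open>x $ e i\<close> is the $i$-th coordinate of \<open>x\<close>. Subsets of $[n]$, the matrix, the right-hand side and the
  coefficient vectors of inequalities are indexed by natural numbers starting from 1; values outside
  the index range are irrelevant.
\<close>

definition numbering :: "(nat \<Rightarrow> 'n::finite) \<Rightarrow> bool" where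
  "numbering e \<longleftrightarrow> bij_betw e {1..CARD('n)} UNIV"

definition knapsack_set ::
  "(nat \<Rightarrow> 'n::finite) \<Rightarrow> nat \<Rightarrow> (nat \<Rightarrow> nat \<Rightarrow> nat) \<Rightarrow> (nat \<Rightarrow> nat) \<Rightarrow> (real ^ 'n) set" where
  "knapsack_set e m A b =
     {x. (\<forall>j\<in>{1..CARD('n)}. x $ e j \<in> {0, 1}) \<and>
         (\<forall>r\<in>{1..m}. (\<Sum>j=1..CARD('n). real (A r j) * x $ e j) \<le> real (b r))}"

definition TOMKS :: "(nat \<Rightarrow> 'n::finite) \<Rightarrow> (real ^ 'n) set \<Rightarrow> bool" where
  "TOMKS e K \<longleftrightarrow>
     (\<exists>m A b. (\<forall>i\<in>{1..CARD('n)}. \<forall>j\<in>{1..CARD('n)}. i \<le> j \<longrightarrow> (\<forall>r\<in>{1..m}. A r j \<le> A r i)) \<and>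
              K = knapsack_set e m A b)"

definition incidence_vec :: "(nat \<Rightarrow> 'n::finite) \<Rightarrow> nat set \<Rightarrow> real ^ 'n" where
  "incidence_vec e S = (\<chi> k. if k \<in> e ` S then 1 else 0)"

definition cover :: "(nat \<Rightarrow> 'n::finite) \<Rightarrow> (real ^ 'n) set \<Rightarrow> nat set \<Rightarrow> bool" where
  "cover e K S \<longleftrightarrow> S \<subseteq> {1..CARD('n)} \<and> incidence_vec e S \<notin> K"

definition minimal_cover :: "(nat \<Rightarrow> 'n::finite) \<Rightarrow> (real ^ 'n) set \<Rightarrow> nat set \<Rightarrow> bool" where
  "minimal_cover e K S \<longleftrightarrow> cover e K S \<and> (\<forall>T. T \<subset> S \<longrightarrow> \<not> cover e K T)"

definition dominates :: "nat set \<Rightarrow> nat set \<Rightarrow> bool"  (infix "\<triangleright>" 50) where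
  "S1 \<triangleright> S2 \<longleftrightarrow> (\<exists>f. inj_on f S2 \<and> f ` S2 \<subseteq> S1 \<and> (\<forall>i\<in>S2. f i \<le> i))"

definition discrepancy_family :: "nat set set \<Rightarrow> nat set set" where
  "discrepancy_family F = (\<lambda>S. S - \<Inter>F) ` F"

definition multi_cover :: "(nat \<Rightarrow> 'n::finite) \<Rightarrow> (real ^ 'n) set \<Rightarrow> nat set set \<Rightarrow> bool" where
  "multi_cover e K F \<longleftrightarrow>
     F \<noteq> {} \<and> (\<forall>S\<in>F. cover e K S) \<and>
     (\<forall>T. T \<subseteq> \<Union>(discrepancy_family F) \<and> T \<notin> discrepancy_family F \<longrightarrow>
          (\<exists>D\<in>discrepancy_family F. T \<triangleright> D \<or> D \<triangleright> T))"

definition Max0 :: "int set \<Rightarrow> int" where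
  "Max0 S = (if S = {} then 0 else Max S)"

text \<open>
  The successive choices of the coefficients are expressed as simultaneous conditions on \<open>\<alpha>\<close>: the
  bound for an index in \<open>\<Union>F - \<Inter>F\<close> only involves larger indices of that same set, and the bound for an index
  in \<open>\<Inter>F\<close> only involves indices of \<open>\<Union>F - \<Inter>F\<close>.
\<close>

definition MCI_of :: "nat set set \<Rightarrow> nat \<Rightarrow> (nat \<Rightarrow> int) \<Rightarrow> int \<Rightarrow> bool" where
  "MCI_of F n \<alpha> \<beta> \<longleftrightarrow>
     (\<forall>i\<in>{1..n} - \<Union>F. \<alpha> i = 0) \<and>
     (\<Union>F - \<Inter>F \<noteq> {} \<longrightarrow> \<alpha> (Max (\<Union>F - \<Inter>F)) = 1) \<and>
     (\<forall>i\<in>\<Union>F - \<Inter>F. i \<noteq> Max (\<Union>F - \<Inter>F) \<longrightarrow>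
        \<alpha> i \<ge> Max0 ((\<lambda>S. Max0 (\<alpha> ` {l \<in> \<Union>F - S. l > i})) ` {S \<in> F. i \<in> S}) + 1) \<and>
     (\<forall>j\<in>\<Inter>F.
        \<alpha> j \<ge> Min ((\<lambda>S. max (Max0 (\<alpha> ` {l \<in> \<Union>F - S. l < j}))
                              ((\<Sum>l\<in>{l \<in> \<Union>F - S. l > j}. \<alpha> l) + 1)) ` F)) \<and>
     \<beta> = Max ((\<lambda>S. \<Sum>i\<in>S. \<alpha> i) ` F) - 1"

definition is_MCI ::
  "(nat \<Rightarrow> 'n::finite) \<Rightarrow> (real ^ 'n) set \<Rightarrow> (nat \<Rightarrow> int) \<Rightarrow> int \<Rightarrow> bool" where
  "is_MCI e K \<alpha> \<beta> \<longleftrightarrow> (\<exists>F. multi_cover e K F \<and> MCI_of F CARD('n) \<alpha> \<beta>)"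

end

theory Submission
  imports Defs
begin

text \<open>
  Let \<open>A = {1..p-1}\<close>, \<open>B = {p+1..q}\<close>, \<open>m = q - p\<close> and \<open>s = \<Sum>\<^sub>A (1 - x\<^sub>i)\<close>. The points of
  \<open>K\<close> are the binary points that vanish at some \<open>a \<in> A\<close>, or at \<open>p\<close> and some \<open>j \<in> B\<close>, or on all of \<open>B\<close>,
  so the hull contains the corresponding faces of the cube. In terms of \<open>s\<close> the inequalities read
  \<open>x\<^sub>p + x\<^sub>j \<le> 1 + s\<close>, \<open>\<Sum>\<^sub>B x \<le> m - 1 + s\<close> and \<open>(m - 1) x\<^sub>p + \<Sum>\<^sub>B x \<le> m - 1 + m s\<close>.
  If \<open>s \<ge> 1\<close>, then \<open>x\<close> is a mixture of points of the first kind. Otherwise \<open>x\<close> is a mixture of three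
  points, one for each kind, with weights \<open>s\<close>, \<open>1 - max s x\<^sub>p\<close> and \<open>max s x\<^sub>p - s\<close>; the first point
  takes as much of \<open>x\<^sub>p\<close> and of every \<open>x\<^sub>j\<close> as its weight permits, and the inequalities say
  exactly that the second one can take the rest.

  The multi-cover inequality comes from the two covers \<open>A \<union> B\<close> and \<open>A \<union> {p, q}\<close>. The family of
  all minimal covers would force coefficients larger than 1 on \<open>B\<close>.
\<close>

section \<open>Faces of the cube and convex combinations\<close>

definition unit_cube :: "(real ^ 'n::finite) set" where
  "unit_cube = {x. \<forall>k. 0 \<le> x $ k \<and> x $ k \<le> 1}"

text \<open>The linear map \<open>L\<close> that clears the coordinates in \<open>Z\<close> sends
  vertices of the cube to vertices of the face and fixes \<open>y\<close>. Applying it to the vertex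
  description of the whole cube therefore gives the one of the face.\<close>

lemma cube_face_hull:
  fixes y :: "real ^ 'n::finite"
  assumes "y \<in> unit_cube" and zero: "\<And>k. k \<in> Z \<Longrightarrow> y $ k = 0"
  shows "y \<in> convex hull {x. (\<forall>k. x $ k \<in> {0, 1}) \<and> (\<forall>k\<in>Z. x $ k = 0)}"
proof -
  define L :: "real ^ 'n \<Rightarrow> real ^ 'n" where "L x = (\<chi> k. if k \<in> Z then 0 else x $ k)" for x
  have lin: "linear L"
    by (rule linearI) (auto simp: L_def vec_eq_iff)
  let ?V = "{x :: real ^ 'n. \<forall>i\<in>Basis. x \<bullet> i = 0 \<or> x \<bullet> i = 1}"
  have V: "?V = {x. \<forall>k. x $ k \<in> {0, 1}}"
    by (auto simp: Basis_vec_def inner_axis)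
  have "y \<in> cbox 0 (\<Sum>Basis)"
    using assms(1) by (simp add: unit_cube_def mem_box) (auto simp: Basis_vec_def inner_axis)
  then have "y \<in> convex hull ?V"
    by (simp only: unit_interval_convex_hull)
  then have "L y \<in> L ` (convex hull ?V)"
    by blast
  also have "\<dots> = convex hull (L ` ?V)"
    using lin by (rule convex_hull_linear_image)
  also have "\<dots> = convex hull (L ` {x. \<forall>k. x $ k \<in> {0, 1}})"
    by (simp only: V)
  also have "\<dots> \<subseteq> convex hull {x. (\<forall>k. x $ k \<in> {0, 1}) \<and> (\<forall>k\<in>Z. x $ k = 0)}"
  proof (intro hull_mono image_subsetI)
    fix x :: "real ^ 'n" assume "x \<in> {x. \<forall>k. x $ k \<in> {0, 1}}"
    then show "L x \<in> {x. (\<forall>k. x $ k \<in> {0, 1}) \<and> (\<forall>k\<in>Z. x $ k = 0)}"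
      by (simp add: L_def)
  qed
  also have "L y = y"
    using zero by (simp add: L_def vec_eq_iff)
  finally show ?thesis .
qed

text \<open>With \<open>T = \<Sum>\<^sub>J (1 - y\<^sub>k)\<close>, choose the vanishing coordinate \<open>j\<close> with weight
  \<open>(1 - y\<^sub>j) / T\<close> and rescale each other coordinate of \<open>J\<close> to keep the average \<open>y\<close>;
  the rescaled coordinates stay at most 1 exactly because \<open>T \<ge> 1\<close>.\<close>

lemma cube_cap_in_convex:
  fixes y :: "real ^ 'n::finite"
  assumes y: "y \<in> unit_cube" and T: "1 \<le> (\<Sum>k\<in>J. 1 - y $ k)" and C: "convex C"
    and face: "\<And>w j. w \<in> unit_cube \<Longrightarrow> j \<in> J \<Longrightarrow> w $ j = 0 \<Longrightarrow>
                 (\<And>k. y $ k = 0 \<Longrightarrow> w $ k = 0) \<Longrightarrow> w \<in> C"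
  shows "y \<in> C"
proof -
  define T where "T = (\<Sum>k\<in>J. 1 - y $ k)"
  define l where "l k = (1 - y $ k) / T" for k
  define w where "w j = (\<chi> i. if i = j then 0 else if i \<in> J then y $ i / (1 - l i) else y $ i)" for j
  have T1: "T \<ge> 1" using assms(2) by (simp add: T_def)
  have yk: "0 \<le> y $ k" "y $ k \<le> 1" for k using y by (auto simp: unit_cube_def)
  have l0: "0 \<le> l k" for k using T1 yk by (simp add: l_def)
  have l1: "y $ k \<le> 1 - l k" for k
  proof -
    have "(1 - y $ k) / T \<le> (1 - y $ k) / 1"
      using T1 yk by (intro divide_left_mono) auto
    then show ?thesis by (simp add: l_def)
  qed
  have suml: "(\<Sum>k\<in>J. l k) = 1"
    using T1 unfolding l_def sum_divide_distrib[symmetric] T_def[symmetric] by simp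
  have wC: "w j \<in> C" if "j \<in> J" for j
  proof (rule face)
    have "0 \<le> y $ k / (1 - l k)" "y $ k / (1 - l k) \<le> 1" for k
      using l1[of k] yk[of k] by (auto simp: divide_le_eq_1)
    then show "w j \<in> unit_cube"
      using yk by (auto simp: unit_cube_def w_def)
  qed (use that in \<open>auto simp: w_def\<close>)
  have "(\<Sum>j\<in>J. l j *\<^sub>R w j) \<in> C"
    using C suml l0 wC by (intro convex_sum) auto
  moreover have "(\<Sum>j\<in>J. l j *\<^sub>R w j) $ i = y $ i" for i
  proof (cases "i \<in> J")
    case True
    have "(\<Sum>j\<in>J. l j *\<^sub>R w j) $ i = (\<Sum>j\<in>J - {i}. l j * w j $ i)"
      using True by (simp add: sum.remove[of J i] w_def[of i])
    also have "\<dots> = (\<Sum>j\<in>J - {i}. l j * (y $ i / (1 - l i)))"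
      using True by (intro sum.cong refl) (auto simp: w_def)
    also have "\<dots> = (1 - l i) * (y $ i / (1 - l i))"
      unfolding sum_distrib_right[symmetric] using True suml by (simp add: sum_diff1)
    \<comment> \<open>If \<open>l i = 1\<close>, then \<open>l1\<close> forces
      \<open>y $ i = 0\<close>, so the value 0 of a division by zero is the right one.\<close>
    also have "\<dots> = y $ i"
      using l1[of i] yk[of i] by (cases "l i = 1") auto
    finally show ?thesis .
  next
    case False
    then have "(\<Sum>j\<in>J. l j *\<^sub>R w j) $ i = (\<Sum>j\<in>J. l j * y $ i)"
      by (auto simp: w_def intro!: sum.cong)
    then show ?thesis using suml by (simp add: sum_distrib_right[symmetric])
  qed
  ultimately show ?thesis by (metis vec_eq_iff)
qed

text \<open>Membership is asked only of points with positive weight: the points used later are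
  defined by division by their own weight and may leave \<open>C\<close> when that weight is 0. Such
  terms are dropped from the sum.\<close>

lemma convex_combination3:
  assumes C: "convex C" and "0 \<le> a" "0 \<le> b" "0 \<le> c" "a + b + c = (1::real)"
    and "0 < a \<Longrightarrow> x \<in> C" and "0 < b \<Longrightarrow> y \<in> C" and "0 < c \<Longrightarrow> z \<in> C"
  shows "a *\<^sub>R x + b *\<^sub>R y + c *\<^sub>R z \<in> C"
proof -
  define f where "f = (\<lambda>i::nat. if i = 0 then a else if i = 1 then b else c)"
  define g where "g = (\<lambda>i::nat. if i = 0 then x else if i = 1 then y else z)"
  have S: "{i \<in> {0,1,2}. 0 < f i} = {0,1,2} - {i \<in> {0,1,2}. f i = 0}"
    using assms by (auto simp: f_def)
  have "(\<Sum>i\<in>{i \<in> {0,1,2}. 0 < f i}. f i *\<^sub>R g i) \<in> C"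
  proof (rule convex_sum[OF _ C])
    have "sum f {i \<in> {0,1,2}. 0 < f i} = sum f {0,1,2}"
      unfolding S by (rule sum.mono_neutral_left) auto
    then show "sum f {i \<in> {0,1,2}. 0 < f i} = 1"
      using assms by (simp add: f_def)
  qed (use assms in \<open>auto simp: f_def g_def split: if_splits\<close>)
  also have "(\<Sum>i\<in>{i \<in> {0,1,2}. 0 < f i}. f i *\<^sub>R g i) = (\<Sum>i\<in>{0,1,2}. f i *\<^sub>R g i)"
    unfolding S by (rule sum.mono_neutral_left) auto
  finally show ?thesis by (simp add: f_def g_def add.assoc)
qed

section \<open>Decomposition of a point along three kinds of faces\<close>

text \<open>The inequalities serve only the point \<open>x2\<close> with \<open>x2 $ c = 0\<close>:
  \<open>h1\<close> keeps its \<open>B\<close>-coordinates at most 1, while \<open>h2\<close> and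
  \<open>h3\<close> leave it enough slack on \<open>B\<close> for
  \<open>cube_cap_in_convex\<close>.\<close>

lemma three_face_decomposition:
  fixes x :: "real ^ 'n::finite" and A B :: "'n set" and c :: 'n
  defines "s \<equiv> \<Sum>k\<in>A. 1 - x $ k"
  assumes disj: "c \<notin> A" "c \<notin> B" "A \<inter> B = {}" and x: "x \<in> unit_cube"
    and h1: "\<And>k. k \<in> B \<Longrightarrow> x $ c + x $ k \<le> 1 + s"
    and h2: "(\<Sum>k\<in>B. x $ k) \<le> real (card B) - 1 + s"
    and h3: "(real (card B) - 1) * x $ c + (\<Sum>k\<in>B. x $ k) \<le> real (card B) - 1 + real (card B) * s"
    and C: "convex C"
    and FA: "\<And>w a. w \<in> unit_cube \<Longrightarrow> a \<in> A \<Longrightarrow> w $ a = 0 \<Longrightarrow> w \<in> C"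
    and FP: "\<And>w j. w \<in> unit_cube \<Longrightarrow> w $ c = 0 \<Longrightarrow> j \<in> B \<Longrightarrow> w $ j = 0 \<Longrightarrow> w \<in> C"
    and FB: "\<And>w. w \<in> unit_cube \<Longrightarrow> (\<And>j. j \<in> B \<Longrightarrow> w $ j = 0) \<Longrightarrow> w \<in> C"
  shows "x \<in> C"
proof (cases "s \<ge> 1")
  case True
  then show ?thesis
    using x C FA unfolding s_def by (intro cube_cap_in_convex[of x A C]) auto
next
  case False
  \<comment> \<open>The point \<open>x3\<close> of weight \<open>s\<close> absorbs
    \<open>min (x $ c) s\<close> of \<open>x $ c\<close>. The rest is \<open>M - s\<close>, the
    weight of \<open>x1\<close>, whose coordinate \<open>c\<close> is 1; so \<open>x2\<close> can
    vanish at \<open>c\<close>.\<close>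
  define M where "M = max s (x $ c)"
  define l where "l = 1 - M"
  have xk: "0 \<le> x $ k" "x $ k \<le> 1" for k using x by (auto simp: unit_cube_def)
  have s0: "0 \<le> s" unfolding s_def using xk by (intro sum_nonneg) auto
  have ts: "1 - x $ k \<le> s" if "k \<in> A" for k
    unfolding s_def using that xk by (intro member_le_sum) auto
  have l0: "0 \<le> l" using False xk by (simp add: l_def M_def)
  \<comment> \<open>This is what \<open>x3\<close> leaves over at \<open>k\<close>. As
    \<open>x1\<close> vanishes on \<open>B\<close>, \<open>x2\<close> must carry all of it with
    weight \<open>l\<close>.\<close>
  define z where "z k = max (x $ k - s) 0" for k
  have zl: "z k \<le> l" if "k \<in> B" for k
    using h1[OF that] xk[of k] l0 by (auto simp: z_def l_def M_def)
  have B0: "B \<noteq> {}" using h2 False by auto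
  have zsum: "(\<Sum>k\<in>B. z k) \<le> (real (card B) - 1) * l"
  \<comment> \<open>If \<open>x $ j < s\<close>, then \<open>z j = 0\<close> and the other terms are
    at most \<open>l\<close> each. Otherwise no maximum in \<open>z\<close> is cut off, and the
    claim is \<open>h3\<close> when \<open>s \<le> x $ c\<close> and follows from \<open>h2\<close>
    when \<open>x $ c < s\<close>.\<close>
  proof (cases "\<exists>j\<in>B. x $ j < s")
    case True
    then obtain j where j: "j \<in> B" "x $ j < s" by blast
    have "(\<Sum>k\<in>B. z k) = (\<Sum>k\<in>B - {j}. z k)"
      using j by (simp add: sum.remove[of B j] z_def)
    also have "\<dots> \<le> (\<Sum>k\<in>B - {j}. l)"
      using zl by (intro sum_mono) auto
    also have "\<dots> = real (card B - 1) * l" using j by simp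
    also have "real (card B - 1) = real (card B) - 1"
      using B0 by (simp add: of_nat_diff Suc_le_eq card_gt_0_iff)
    finally show ?thesis .
  next
    case False
    then have "(\<Sum>k\<in>B. z k) = (\<Sum>k\<in>B. x $ k - s)"
      by (intro sum.cong) (auto simp: z_def)
    also have "\<dots> = (\<Sum>k\<in>B. x $ k) - real (card B) * s"
      by (simp add: sum_subtractf)
    finally show ?thesis
      using h2 h3 by (cases "s \<le> x $ c") (simp_all add: l_def M_def algebra_simps)
  qed
  \<comment> \<open>Since \<open>x1\<close> and \<open>x2\<close> are 1 on \<open>A\<close>,
    \<open>x3\<close> carries the whole deficit there. Rescaled by its weight \<open>s\<close>, the
    deficit totals exactly 1, the threshold of \<open>cube_cap_in_convex\<close>.\<close>
  define x1 where "x1 = (\<chi> k. if k \<in> A \<or> k = c then 1 else if k \<in> B then 0 else x $ k)"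
  define x2 where "x2 = (\<chi> k. if k \<in> A then 1 else if k = c then 0
                              else if k \<in> B then z k / l else x $ k)"
  define x3 where "x3 = (\<chi> k. if k \<in> A then 1 - (1 - x $ k) / s
                              else if k = c \<or> k \<in> B then min (x $ k) s / s else x $ k)"
  have "s *\<^sub>R x3 + (M - s) *\<^sub>R x1 + l *\<^sub>R x2 \<in> C"
  proof (rule convex_combination3[OF C])
    show "0 \<le> M - s" "s + (M - s) + l = 1" by (auto simp: M_def l_def)
    show "x3 \<in> C" if "0 < s"
    proof (rule cube_cap_in_convex[of x3 A C])
      show "x3 \<in> unit_cube"
        using that xk ts by (auto simp: unit_cube_def x3_def)
      have "(\<Sum>k\<in>A. 1 - x3 $ k) = (\<Sum>k\<in>A. (1 - x $ k) / s)"
        by (intro sum.cong) (auto simp: x3_def)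
      also have "\<dots> = 1"
        using that unfolding sum_divide_distrib[symmetric] s_def[symmetric] by simp
      finally show "1 \<le> (\<Sum>k\<in>A. 1 - x3 $ k)" by simp
    qed (use C FA in auto)
    show "x1 \<in> C"
      using disj xk by (intro FB) (auto simp: unit_cube_def x1_def)
    show "x2 \<in> C" if "0 < l"
    proof (rule cube_cap_in_convex[of x2 B C])
      show "x2 \<in> unit_cube"
        using that xk zl by (auto simp: unit_cube_def x2_def z_def)
      have "(\<Sum>k\<in>B. 1 - x2 $ k) = (\<Sum>k\<in>B. 1 - z k / l)"
        using disj by (intro sum.cong) (auto simp: x2_def)
      also have "\<dots> = real (card B) - (\<Sum>k\<in>B. z k) / l"
        by (simp add: sum_subtractf sum_divide_distrib)
      also have "\<dots> \<ge> 1"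
        using zsum that by (simp add: field_simps)
      finally show "1 \<le> (\<Sum>k\<in>B. 1 - x2 $ k)" .
    next
      \<comment> \<open>The points produced by \<open>cube_cap_in_convex\<close> inherit the zeros
        of \<open>x2\<close>; the one at \<open>c\<close> makes \<open>FP\<close> applicable to
        them.\<close>
      have "x2 $ c = 0" using disj by (simp add: x2_def)
      then show "w \<in> C" if "w \<in> unit_cube" "j \<in> B" "w $ j = 0" "\<And>k. x2 $ k = 0 \<Longrightarrow> w $ k = 0" for w j
        using FP that by blast
    qed (rule C)
  qed (use s0 l0 in auto)
  also have "s *\<^sub>R x3 + (M - s) *\<^sub>R x1 + l *\<^sub>R x2 = x"
  proof -
    have "s * x3 $ k + (M - s) * x1 $ k + l * x2 $ k = x $ k" for k
    proof -
      \<comment> \<open>Zero weights do no harm: \<open>s = 0\<close> gives \<open>x $ k = 1\<close>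
        on \<open>A\<close> by \<open>ts\<close> and \<open>min (x $ k) s = 0\<close> elsewhere, and
        \<open>l = 0\<close> gives \<open>z k = 0\<close> by \<open>zl\<close>.\<close>
      consider "k \<in> A" | "k = c" | "k \<in> B" | "k \<notin> A" "k \<noteq> c" "k \<notin> B" by blast
      then show ?thesis
      proof cases
        case 1
        have "s * ((1 - x $ k) / s) = 1 - x $ k"
          using ts[OF 1] xk[of k] by (cases "s = 0") auto
        then show ?thesis using 1
          by (simp add: x1_def x2_def x3_def l_def right_diff_distrib)
      next
        case 2
        then show ?thesis using disj xk[of c] s0
          by (cases "s = 0") (auto simp: x1_def x2_def x3_def M_def min_def max_def)
      next
        case 3
        then have "k \<noteq> c" "k \<notin> A" using disj by auto
        moreover have "s * (min (x $ k) s / s) = min (x $ k) s"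
          using xk[of k] by (cases "s = 0") auto
        moreover have "l * (z k / l) = z k"
          using zl[OF 3] by (cases "l = 0") (auto simp: z_def)
        ultimately show ?thesis using 3
          by (simp add: x1_def x2_def x3_def z_def min_def max_def)
      next
        case 4
        then show ?thesis by (simp add: x1_def x2_def x3_def l_def algebra_simps)
      qed
    qed
    then show ?thesis by (simp add: vec_eq_iff)
  qed
  finally show ?thesis .
qed

section \<open>Minimal covers and membership in a knapsack set\<close>

lemma cover_contains_minimal_cover:
  assumes "cover e K S"
  shows "\<exists>M \<subseteq> S. minimal_cover e K M"
proof -
  have "finite S" using assms finite_subset by (auto simp: cover_def)
  then show ?thesis using assms
  proof (induction S rule: finite_psubset_induct)
    case (psubset S)
    show ?case
    proof (cases "minimal_cover e K S")
      case False
      then obtain T where T: "T \<subset> S" "cover e K T"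
        using psubset.prems by (auto simp: minimal_cover_def)
      then show ?thesis using psubset.IH[OF T] by blast
    qed auto
  qed
qed

lemma incidence_vec_nth:
  assumes "numbering e" "S \<subseteq> {1..CARD('n)}" "i \<in> {1..CARD('n)}"
  shows "incidence_vec (e :: nat \<Rightarrow> 'n::finite) S $ e i = (if i \<in> S then 1 else 0)"
proof -
  have "inj_on e {1..CARD('n)}" using assms(1) by (simp add: numbering_def bij_betw_def)
  then have "e i \<in> e ` S \<longleftrightarrow> i \<in> S" using assms(2,3) by (intro inj_on_image_mem_iff)
  then show ?thesis by (simp add: incidence_vec_def)
qed

lemma knapsack_set_antimono:
  assumes "x \<in> knapsack_set e m A b"
    and "\<And>j. j \<in> {1..CARD('n)} \<Longrightarrow> y $ e j \<in> {0, 1} \<and> y $ e j \<le> x $ e j"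
  shows "y \<in> knapsack_set (e :: nat \<Rightarrow> 'n::finite) m A b"
proof -
  have "(\<Sum>j=1..CARD('n). real (A r j) * y $ e j) \<le> (\<Sum>j=1..CARD('n). real (A r j) * x $ e j)" for r
    using assms(2) by (intro sum_mono mult_left_mono) auto
  moreover have "(\<Sum>j=1..CARD('n). real (A r j) * x $ e j) \<le> real (b r)" if "r \<in> {1..m}" for r
    using assms(1) that unfolding knapsack_set_def by blast
  ultimately show ?thesis
    using assms(2) unfolding knapsack_set_def by (blast intro: order_trans)
qed

text \<open>A binary point is the incidence vector of its support, and the support is a cover iff it
  contains a minimal one. The direction from \<open>K\<close> uses that nonnegative entries make
  \<open>K\<close> closed under lowering coordinates.\<close>

lemma TOMKS_mem_iff:
  fixes e :: "nat \<Rightarrow> 'n::finite"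
  assumes e: "numbering e" and K: "TOMKS e K"
  shows "x \<in> K \<longleftrightarrow> (\<forall>k. x $ k \<in> {0, 1}) \<and> \<not> (\<exists>M. minimal_cover e K M \<and> (\<forall>i\<in>M. x $ e i = 1))"
proof -
  obtain m A b where Kdef: "K = knapsack_set e m A b"
    using K by (auto simp: TOMKS_def)
  have range: "\<exists>i\<in>{1..CARD('n)}. k = e i" for k
    using e by (metis (mono_tags) UNIV_I bij_betw_def imageE numbering_def)
  have binary: "(\<forall>k. x $ k \<in> {0, 1})" if "x \<in> K"
    using that range unfolding Kdef knapsack_set_def by (metis (mono_tags, lifting) mem_Collect_eq)
  have no_cover: "\<not> (minimal_cover e K M \<and> (\<forall>i\<in>M. x $ e i = 1))" if x: "x \<in> K" for M
  proof safe
    assume M: "minimal_cover e K M" "\<forall>i\<in>M. x $ e i = 1"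
    then have sub: "M \<subseteq> {1..CARD('n)}" and notin: "incidence_vec e M \<notin> K"
      by (auto simp: minimal_cover_def cover_def)
    have "incidence_vec e M \<in> K"
      unfolding Kdef
    proof (rule knapsack_set_antimono[OF x[unfolded Kdef]])
      fix j assume "j \<in> {1..CARD('n)}"
      then show "incidence_vec e M $ e j \<in> {0, 1} \<and> incidence_vec e M $ e j \<le> x $ e j"
        using incidence_vec_nth[OF e sub] M(2) binary[OF x] by (auto split: if_splits)
          (metis empty_iff insert_iff order_refl zero_le_one)
    qed
    then show False using notin by simp
  qed
  have "x \<in> K" if bin: "\<forall>k. x $ k \<in> {0, 1}" and nc: "\<not> (\<exists>M. minimal_cover e K M \<and> (\<forall>i\<in>M. x $ e i = 1))"
  proof -
    define S where "S = {i \<in> {1..CARD('n)}. x $ e i = 1}"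
    have S: "S \<subseteq> {1..CARD('n)}" by (auto simp: S_def)
    have "x $ k = incidence_vec e S $ k" for k
    proof -
      obtain i where i: "i \<in> {1..CARD('n)}" "k = e i" using range by blast
      then show ?thesis using incidence_vec_nth[OF e S i(1)] bin by (auto simp: S_def)
    qed
    then have "incidence_vec e S = x" by (simp add: vec_eq_iff)
    moreover have "\<not> cover e K S"
    proof
      assume "cover e K S"
      then obtain M where "M \<subseteq> S" "minimal_cover e K M"
        using cover_contains_minimal_cover by blast
      then show False using nc by (auto simp: S_def)
    qed
    ultimately show ?thesis using S by (simp add: cover_def)
  qed
  with binary no_cover show ?thesis by blast
qed

lemma convex_linear_le:
  assumes "linear (f :: 'a::real_vector \<Rightarrow> real)"
  shows "convex {x. f x \<le> c}"
proof -
  have "{x. f x \<le> c} = f -` {..c}" by auto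
  then show ?thesis using convex_linear_vimage[OF assms] by simp
qed

section \<open>The multi-cover and its inequality\<close>

lemma superset_dominates:
  assumes "S2 \<subseteq> S1" shows "S1 \<triangleright> S2"
  unfolding dominates_def using assms by (intro exI[of _ "\<lambda>i. i"]) auto

text \<open>The discrepancy family is \<open>{p+1..q-1}\<close> and \<open>{p}\<close>. A set
  \<open>T\<close> in their union either contains \<open>p\<close> or lies inside
  \<open>{p+1..q-1}\<close>, so inclusion alone gives a dominance.\<close>

lemma multi_cover_pair:
  fixes p q :: nat
  assumes "p + 2 \<le> q" and "cover e K ({1..p-1} \<union> {p+1..q})" and "cover e K ({1..p} \<union> {q})" and "1 \<le> p"
  shows "multi_cover e K {{1..p-1} \<union> {p+1..q}, {1..p} \<union> {q}}"
proof -
  let ?F = "{{1..p-1} \<union> {p+1..q}, {1..p} \<union> {q}}"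
  have D: "discrepancy_family ?F = {{p+1..q-1}, {p}}"
    using assms by (auto simp: discrepancy_family_def)
  have "\<exists>D\<in>{{p+1..q-1}, {p}}. T \<triangleright> D \<or> D \<triangleright> T" if T: "T \<subseteq> \<Union>{{p+1..q-1}, {p}}" for T
  proof (cases "p \<in> T")
    case True
    then show ?thesis using superset_dominates[of "{p}" T] by auto
  next
    case False
    then show ?thesis using T superset_dominates[of T "{p+1..q-1}"] by auto
  qed
  then show ?thesis
    using assms(2,3) unfolding multi_cover_def D by simp
qed

text \<open>Both covers have the same weight \<open>p * (q - p)\<close>, which yields the right-hand
  side. The index \<open>q\<close> lies in both covers, so its coefficient 1 falls under the rule
  for the intersection.\<close>

lemma MCI_of_pair:
  fixes p q n :: nat
  assumes "1 \<le> p" "p + 3 \<le> q"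
  shows "MCI_of {{1..p-1} \<union> {p+1..q}, {1..p} \<union> {q}} n
           (\<lambda>i. if i < p then int q - int p
                else if i = p then int q - int p - 1
                else if i \<le> q then 1 else 0)
           (int p * (int q - int p) - 1)"
proof -
  define S1 S2 where S: "S1 = {1..p-1} \<union> {p+1..q}" "S2 = {1..p} \<union> {q}"
  define F where F: "F = {S1, S2}"
  define \<alpha> where "\<alpha> = (\<lambda>i. if i < p then int q - int p
                          else if i = p then int q - int p - 1
                          else if i \<le> q then 1 else 0)"
  have \<alpha>_lt: "\<alpha> i = int q - int p" if "i < p" for i using that by (simp add: \<alpha>_def)
  have \<alpha>_p: "\<alpha> p = int q - int p - 1" by (simp add: \<alpha>_def)
  have \<alpha>_gt: "\<alpha> i = 1" if "p < i" "i \<le> q" for i using that by (simp add: \<alpha>_def)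
  have U: "\<Union>F = {1..q}" using assms by (auto simp: F S)
  have I: "\<Inter>F = {1..p-1} \<union> {q}" using assms by (auto simp: F S)
  have UI: "\<Union>F - \<Inter>F = {p..q-1}" unfolding U I using assms by auto
  have S1: "{1..q} - S1 = {p}" and S2: "{1..q} - S2 = {p+1..q-1}" using assms by (auto simp: S)
  have M: "Max {p..q-1} = q - 1" using assms by (intro Max_eqI) auto
  have c1: "{l \<in> \<Union>F - S1. l > i} = (if i < p then {p} else {})" for i
    unfolding U S1 by auto
  have c1': "{l \<in> \<Union>F - S1. l < i} = (if p < i then {p} else {})" for i
    unfolding U S1 by auto
  have c2: "{l \<in> \<Union>F - S2. l > i} = {max (p+1) (i+1)..q-1}" for i
    unfolding U S2 by auto
  have c2': "{l \<in> \<Union>F - S2. l < i} = {p+1..<min i q}" for i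
    unfolding U S2 using assms by auto
  have max1: "Max0 (\<alpha> ` X) \<le> 1" if "X \<subseteq> {p+1..q}" for X
  proof (cases "X = {}")
    case False
    have "\<alpha> ` X = (\<lambda>_. 1) ` X" using that \<alpha>_gt by (auto simp: subset_iff Suc_le_eq intro!: image_cong)
    then have "\<alpha> ` X = {1}" using False by (simp add: image_constant_conv)
    then show ?thesis by (simp add: Max0_def)
  qed (simp add: Max0_def)
  have sumA: "(\<Sum>l\<in>{1..p-1}. \<alpha> l) = int (p - 1) * (int q - int p)"
  proof -
    have "(\<Sum>l\<in>{1..p-1}. \<alpha> l) = (\<Sum>l\<in>{1..p-1}. int q - int p)" using assms by (intro sum.cong) (auto simp: \<alpha>_lt)
    then show ?thesis by simp
  qed
  have b1: "(\<Sum>l\<in>S1. \<alpha> l) = int p * (int q - int p)"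
  proof -
    have "(\<Sum>l\<in>S1. \<alpha> l) = (\<Sum>l\<in>{1..p-1}. \<alpha> l) + (\<Sum>l\<in>{p+1..q}. \<alpha> l)"
      unfolding S by (intro sum.union_disjoint) auto
    also have "(\<Sum>l\<in>{p+1..q}. \<alpha> l) = (\<Sum>l\<in>{p+1..q}. 1)" by (intro sum.cong) (auto simp: \<alpha>_gt)
    finally show ?thesis unfolding sumA using assms by (simp add: of_nat_diff algebra_simps)
  qed
  have b2: "(\<Sum>l\<in>S2. \<alpha> l) = int p * (int q - int p)"
  proof -
    have "S2 = {1..p-1} \<union> {p, q}" using assms by (auto simp: S)
    then have "(\<Sum>l\<in>S2. \<alpha> l) = (\<Sum>l\<in>{1..p-1} \<union> {p, q}. \<alpha> l)" by simp
    also have "\<dots> = (\<Sum>l\<in>{1..p-1}. \<alpha> l) + (\<Sum>l\<in>{p, q}. \<alpha> l)"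
      using assms by (intro sum.union_disjoint) auto
    also have "(\<Sum>l\<in>{p, q}. \<alpha> l) = int q - int p" using assms by (simp add: \<alpha>_p \<alpha>_gt)
    finally show ?thesis unfolding sumA using assms by (simp add: of_nat_diff algebra_simps)
  qed
  have "MCI_of F n \<alpha> (int p * (int q - int p) - 1)"
    unfolding MCI_of_def
  proof (intro conjI ballI impI)
    fix i assume "i \<in> {1..n} - \<Union>F"
    then show "\<alpha> i = 0" unfolding U using assms by (auto simp: \<alpha>_def)
  next
    show "\<alpha> (Max (\<Union>F - \<Inter>F)) = 1" unfolding UI M using assms by (intro \<alpha>_gt) auto
  next
    fix i assume i: "i \<in> \<Union>F - \<Inter>F" "i \<noteq> Max (\<Union>F - \<Inter>F)"
    then have i: "p \<le> i" "i < q - 1" unfolding UI M by auto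
    show "Max0 ((\<lambda>S. Max0 (\<alpha> ` {l \<in> \<Union>F - S. l > i})) ` {S \<in> F. i \<in> S}) + 1 \<le> \<alpha> i"
    proof (cases "i = p")
      case True
      then have "{S \<in> F. i \<in> S} = {S2}" using assms by (auto simp: F S)
      moreover have "Max0 (\<alpha> ` {l \<in> \<Union>F - S2. l > i}) \<le> 1"
        unfolding c2 using assms by (intro max1) auto
      \<comment> \<open>Here \<open>p + 3 \<le> q\<close> is essential: \<open>S2\<close> omits
        \<open>p+1\<close>, whose coefficient is 1, so the rule demands at least 2 at
        \<open>p\<close>, where the coefficient is \<open>q - p - 1\<close>.\<close>
      moreover have "2 \<le> \<alpha> i" using True assms by (simp add: \<alpha>_p)
      ultimately show ?thesis by (simp add: Max0_def[of "{_}"])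
    next
      case False
      then have "{S \<in> F. i \<in> S} = {S1}" using assms i by (auto simp: F S)
      moreover have "{l \<in> \<Union>F - S1. l > i} = {}" unfolding c1 using i by simp
      moreover have "\<alpha> i = 1" using i False by (intro \<alpha>_gt) auto
      ultimately show ?thesis by (simp add: Max0_def)
    qed
  next
    fix j assume "j \<in> \<Inter>F"
    then consider "j \<in> {1..p-1}" | "j = q" unfolding I by auto
    \<comment> \<open>One cover suffices to bound the minimum. For \<open>j < p\<close> take
      \<open>S1\<close>, which omits only \<open>p\<close> and demands
      \<open>\<alpha> p + 1 = q - p\<close>. For \<open>j = q\<close> take \<open>S2\<close>: it
      omits only smaller indices, all of coefficient 1.\<close>
    then have "\<exists>S\<in>F. max (Max0 (\<alpha> ` {l \<in> \<Union>F - S. l < j}))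
                   ((\<Sum>l\<in>{l \<in> \<Union>F - S. l > j}. \<alpha> l) + 1) \<le> \<alpha> j"
    proof cases
      case 1
      then have "max (Max0 (\<alpha> ` {l \<in> \<Union>F - S1. l < j}))
                   ((\<Sum>l\<in>{l \<in> \<Union>F - S1. l > j}. \<alpha> l) + 1) \<le> \<alpha> j"
        unfolding c1 c1' using assms by (auto simp: Max0_def \<alpha>_p \<alpha>_lt)
      then show ?thesis by (auto simp: F)
    next
      case 2
      have "Max0 (\<alpha> ` {l \<in> \<Union>F - S2. l < j}) \<le> 1"
        unfolding c2' by (intro max1) auto
      moreover have "(\<Sum>l\<in>{l \<in> \<Union>F - S2. l > j}. \<alpha> l) = 0"
        unfolding c2 using 2 by simp
      moreover have "\<alpha> j = 1" using 2 assms by (intro \<alpha>_gt) auto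
      ultimately have "max (Max0 (\<alpha> ` {l \<in> \<Union>F - S2. l < j}))
                   ((\<Sum>l\<in>{l \<in> \<Union>F - S2. l > j}. \<alpha> l) + 1) \<le> \<alpha> j"
        by linarith
      then show ?thesis by (auto simp: F)
    qed
    then show "Min ((\<lambda>S. max (Max0 (\<alpha> ` {l \<in> \<Union>F - S. l < j}))
                   ((\<Sum>l\<in>{l \<in> \<Union>F - S. l > j}. \<alpha> l) + 1)) ` F) \<le> \<alpha> j"
      unfolding F by (subst Min_le_iff) auto
  next
    show "int p * (int q - int p) - 1 = Max ((\<lambda>S. \<Sum>l\<in>S. \<alpha> l) ` F) - 1"
      by (simp add: F b1 b2)
  qed
  then show ?thesis unfolding F S \<alpha>_def .
qed

section \<open>The convex hull and the multi-cover inequality\<close>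

theorem theorem5:
  fixes e :: "nat \<Rightarrow> 'n::finite" and K :: "(real ^ 'n) set" and p q :: nat
  assumes "numbering e"
    and "TOMKS e K"
    and "1 \<le> p" and "p + 2 \<le> q" and "q \<le> CARD('n)"
    and "{S. minimal_cover e K S} =
           {{1..p-1} \<union> {p+1..q}} \<union> {{1..p} \<union> {i} | i. i \<in> {p+1..q}}"
  shows "convex hull K =
           {x. (\<forall>i\<in>{1..CARD('n)}. 0 \<le> x $ e i \<and> x $ e i \<le> 1) \<and>
               (\<forall>j\<in>{p+1..q}. (\<Sum>i=1..p. x $ e i) + x $ e j \<le> real p) \<and>
               (\<Sum>i=1..p-1. x $ e i) + (\<Sum>i=p+1..q. x $ e i) \<le> real q - 2 \<and>
               (real q - real p) * (\<Sum>i=1..p-1. x $ e i) + (real q - real p - 1) * x $ e p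
                 + (\<Sum>i=p+1..q. x $ e i) \<le> real p * (real q - real p) - 1}
         \<and> (p + 3 \<le> q \<longrightarrow>
              is_MCI e K
                (\<lambda>i. if i < p then int q - int p
                     else if i = p then int q - int p - 1
                     else if i \<le> q then 1 else 0)
                (int p * (int q - int p) - 1))"
proof (intro conjI impI)
  let ?n = "CARD('n)"
  let ?B = "{p+1..q}"
  let ?m = "real q - real p"
  have p1: "1 \<le> p" and pq: "p + 2 \<le> q" and qn: "q \<le> ?n" using assms(3-5) .
  have inj: "inj_on e {1..?n}" and surj: "e ` {1..?n} = UNIV"
    using assms(1) by (auto simp: numbering_def bij_betw_def)
  have min_cover: "minimal_cover e K M \<longleftrightarrow> M = {1..p-1} \<union> ?B \<or> (\<exists>i\<in>?B. M = {1..p} \<union> {i})" for M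
    using assms(6) by blast
  have p_split: "{1..p} = insert p {1..p-1}" using p1 by auto
  have memK: "x \<in> K \<longleftrightarrow> (\<forall>k. x $ k \<in> {0, 1}) \<and>
      ((\<exists>i\<in>{1..p-1}. x $ e i = 0) \<or> (x $ e p = 0 \<and> (\<exists>j\<in>?B. x $ e j = 0)) \<or> (\<forall>j\<in>?B. x $ e j = 0))" for x
  proof (cases "\<forall>k. x $ k \<in> {0, 1}")
    case True
    then have one: "x $ k = 1 \<longleftrightarrow> x $ k \<noteq> 0" for k by (metis empty_iff insert_iff zero_neq_one)
    \<comment> \<open>Negating the existence of a cover yields "some and all coordinates on
      \<open>?B\<close> vanish"; as \<open>?B\<close> is nonempty, this reduces to "all".\<close>
    have "q \<in> ?B" using pq by simp
    have "(\<exists>M. minimal_cover e K M \<and> (\<forall>i\<in>M. x $ e i = 1)) \<longleftrightarrow>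
        (\<forall>i\<in>{1..p-1}. x $ e i \<noteq> 0) \<and> ((\<forall>i\<in>?B. x $ e i \<noteq> 0) \<or> x $ e p \<noteq> 0 \<and> (\<exists>i\<in>?B. x $ e i \<noteq> 0))"
      unfolding min_cover p_split one by blast
    then show ?thesis
      unfolding TOMKS_mem_iff[OF assms(1,2)] using \<open>q \<in> ?B\<close> True by blast
  next
    case False
    then show ?thesis unfolding TOMKS_mem_iff[OF assms(1,2)] by blast
  qed
  have sum_p: "(\<Sum>i=1..p. f i) = (\<Sum>i=1..p-1. f i) + f p" for f :: "nat \<Rightarrow> real"
    unfolding p_split using p1 by simp

  let ?P = "{x :: real ^ 'n. (\<forall>i\<in>{1..?n}. 0 \<le> x $ e i \<and> x $ e i \<le> 1) \<and>
               (\<forall>j\<in>?B. (\<Sum>i=1..p. x $ e i) + x $ e j \<le> real p) \<and>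
               (\<Sum>i=1..p-1. x $ e i) + (\<Sum>i=p+1..q. x $ e i) \<le> real q - 2 \<and>
               ?m * (\<Sum>i=1..p-1. x $ e i) + (?m - 1) * x $ e p
                 + (\<Sum>i=p+1..q. x $ e i) \<le> real p * ?m - 1}"
  show "convex hull K = ?P"
  proof
    show "convex hull K \<subseteq> ?P"
    proof (rule hull_minimal)
      show "K \<subseteq> ?P"
      proof
        fix x assume x: "x \<in> K"
        then have bin: "x $ k = 0 \<or> x $ k = 1" for k by (auto simp: memK)
        have x01: "0 \<le> x $ k \<and> x $ k \<le> 1" for k using bin[of k] by auto
        have sum_le: "(\<Sum>i\<in>S. x $ e i) \<le> real (card S)" for S
          using x01 sum_bounded_above[of S "\<lambda>i. x $ e i" 1] by auto
        have sum_less: "(\<Sum>i\<in>S. x $ e i) \<le> real (card S) - 1" if "finite S" "j \<in> S" "x $ e j = 0" for S j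
        proof -
          have "(\<Sum>i\<in>S. x $ e i) = (\<Sum>i\<in>S - {j}. x $ e i)"
            using that by (simp add: sum.remove)
          also have "\<dots> \<le> real (card (S - {j}))" by (rule sum_le)
          also have "\<dots> = real (card S) - 1"
            using that card_gt_0_iff[of S] by (auto simp: of_nat_diff Suc_le_eq)
          finally show ?thesis .
        qed
        define a where "a = (\<Sum>i=1..p-1. x $ e i)"
        define z where "z = (\<Sum>i=p+1..q. x $ e i)"
        have a: "a \<le> real p - 1" and z: "z \<le> ?m"
          using sum_le[of "{1..p-1}"] sum_le[of ?B] p1 pq by (auto simp: a_def z_def of_nat_diff)
        have m2: "2 \<le> ?m" using pq by (simp add: of_nat_diff)
        have "(\<forall>j\<in>?B. a + x $ e p + x $ e j \<le> real p) \<and> a + z \<le> real q - 2 \<and>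
              ?m * a + (?m - 1) * x $ e p + z \<le> real p * ?m - 1"
        proof -
          \<comment> \<open>With all coordinates 1, the left side of the last inequality exceeds the
            right by \<open>?m\<close>. Case \<open>A\<close> saves \<open>?m\<close> in the first
            term, \<open>P\<close> saves \<open>?m - 1\<close> at \<open>p\<close> and 1 in
            \<open>z\<close>, and \<open>B\<close> saves \<open>?m\<close> in
            \<open>z\<close>.\<close>
          consider (A) "\<exists>i\<in>{1..p-1}. x $ e i = 0" | (P) "x $ e p = 0" "\<exists>j\<in>?B. x $ e j = 0"
            | (B) "\<forall>j\<in>?B. x $ e j = 0"
            using x by (auto simp: memK)
          then show ?thesis
          proof cases
            case A
            then have a: "a \<le> real p - 2"
              using sum_less[of "{1..p-1}"] p1 by (auto simp: a_def of_nat_diff)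
            have "?m * a \<le> ?m * (real p - 2)" using a m2 by (intro mult_left_mono) auto
            moreover have "(?m - 1) * x $ e p \<le> (?m - 1) * 1"
              using m2 x01 by (intro mult_left_mono) auto
            ultimately have "?m * a + (?m - 1) * x $ e p + z \<le> real p * ?m - 1"
              using z by (simp add: algebra_simps)
            moreover have "a + x $ e p + x $ e j \<le> real p" for j
              using a x01[of "e p"] x01[of "e j"] by linarith
            ultimately show ?thesis using a z by simp
          next
            case P
            then have z: "z \<le> ?m - 1"
              using sum_less[of ?B] pq by (auto simp: z_def of_nat_diff)
            have "?m * a \<le> ?m * (real p - 1)" using a m2 by (intro mult_left_mono) auto
            then have "?m * a + (?m - 1) * x $ e p + z \<le> real p * ?m - 1"
              using z P by (simp add: algebra_simps)
            moreover have "a + x $ e p + x $ e j \<le> real p" for j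
              using a P x01[of "e j"] by linarith
            ultimately show ?thesis using a z by simp
          next
            case B
            then have z: "z = 0" by (simp add: z_def)
            have "?m * a \<le> ?m * (real p - 1)" using a m2 by (intro mult_left_mono) auto
            moreover have "(?m - 1) * x $ e p \<le> (?m - 1) * 1"
              using m2 x01 by (intro mult_left_mono) auto
            ultimately have "?m * a + (?m - 1) * x $ e p + z \<le> real p * ?m - 1"
              using z by (simp add: algebra_simps)
            moreover have "a + x $ e p + x $ e j \<le> real p" if "j \<in> ?B" for j
              using a B that x01[of "e p"] by auto
            ultimately show ?thesis using a z m2 by simp
          qed
        qed
        then show "x \<in> ?P" using x01 unfolding mem_Collect_eq sum_p a_def z_def by blast
      qed
      have lin: "linear (\<lambda>x :: real ^ 'n. x $ k)"
        "linear (\<lambda>x :: real ^ 'n. - x $ k)"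
        "linear (\<lambda>x :: real ^ 'n. (\<Sum>i=1..p. x $ e i) + x $ e j)"
        "linear (\<lambda>x :: real ^ 'n. (\<Sum>i=1..p-1. x $ e i) + (\<Sum>i=p+1..q. x $ e i))"
        "linear (\<lambda>x :: real ^ 'n. ?m * (\<Sum>i=1..p-1. x $ e i) + (?m - 1) * x $ e p + (\<Sum>i=p+1..q. x $ e i))"
        for k j
        by (rule linearI; simp add: sum.distrib algebra_simps flip: sum_distrib_left)+
      have P_eq: "?P = (\<Inter>i\<in>{1..?n}. {x. - x $ e i \<le> 0} \<inter> {x. x $ e i \<le> 1}) \<inter>
          ((\<Inter>j\<in>?B. {x. (\<Sum>i=1..p. x $ e i) + x $ e j \<le> real p}) \<inter>
           ({x. (\<Sum>i=1..p-1. x $ e i) + (\<Sum>i=p+1..q. x $ e i) \<le> real q - 2} \<inter>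
            {x. ?m * (\<Sum>i=1..p-1. x $ e i) + (?m - 1) * x $ e p + (\<Sum>i=p+1..q. x $ e i) \<le> real p * ?m - 1}))"
        by auto
      show "convex ?P"
        unfolding P_eq by (intro convex_Int convex_INT convex_linear_le lin)
    qed
    show "?P \<subseteq> convex hull K"
    proof
      fix x assume x: "x \<in> ?P"
      define A where "A = e ` {1..p-1}"
      define B where "B = e ` ?B"
      have injA: "inj_on e {1..p-1}" and injB: "inj_on e ?B"
        by (rule inj_on_subset[OF inj]; use pq qn in auto)+
      have e_eq: "e i = e j \<longleftrightarrow> i = j" if "1 \<le> i" "i \<le> q" "1 \<le> j" "j \<le> q" for i j
        using inj_on_eq_iff[OF inj] that qn by simp
      have sumA: "(\<Sum>k\<in>A. f k) = (\<Sum>i=1..p-1. f (e i))" and sumB: "(\<Sum>k\<in>B. f k) = (\<Sum>i=p+1..q. f (e i))"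
        for f :: "'n \<Rightarrow> real"
        using injA injB by (simp_all add: A_def B_def sum.reindex)
      have cardB: "real (card B) = ?m"
        using injB pq by (simp add: B_def card_image of_nat_diff)
      \<comment> \<open>This substitution turns the inequalities of \<open>?P\<close> into the
        premises \<open>h1\<close>, \<open>h2\<close> and \<open>h3\<close> of the
        decomposition.\<close>
      have slack: "(\<Sum>k\<in>A. 1 - x $ k) = real p - 1 - (\<Sum>i=1..p-1. x $ e i)"
        using p1 unfolding sumA by (simp add: sum_subtractf of_nat_diff)
      have face: "w \<in> convex hull K"
        if "w \<in> unit_cube" "\<forall>k\<in>Z. w $ k = 0" "\<And>v. \<forall>k. v $ k \<in> {0, 1} \<Longrightarrow> \<forall>k\<in>Z. v $ k = 0 \<Longrightarrow> v \<in> K" for w Z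
      proof -
        have "w \<in> convex hull {v. (\<forall>k. v $ k \<in> {0, 1}) \<and> (\<forall>k\<in>Z. v $ k = 0)}"
          using that(1,2) by (intro cube_face_hull) auto
        also have "\<dots> \<subseteq> convex hull K" using that(3) by (intro hull_mono) auto
        finally show ?thesis .
      qed
      show "x \<in> convex hull K"
      proof (rule three_face_decomposition[where A = A and B = B and c = "e p"])
        show "e p \<notin> A" "e p \<notin> B" "A \<inter> B = {}"
          using p1 pq by (auto simp: A_def B_def e_eq)
        show "x \<in> unit_cube"
          unfolding unit_cube_def
        proof safe
          fix k
          obtain i where "i \<in> {1..?n}" "k = e i" using surj by (metis UNIV_I imageE)
          then show "0 \<le> x $ k" "x $ k \<le> 1" using x by auto
        qed
        show "x $ e p + x $ k \<le> 1 + (\<Sum>k\<in>A. 1 - x $ k)" if "k \<in> B" for k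
          using x that unfolding slack sum_p by (auto simp: B_def)
        show "(\<Sum>k\<in>B. x $ k) \<le> real (card B) - 1 + (\<Sum>k\<in>A. 1 - x $ k)"
          using x unfolding slack cardB sumB by auto
        show "(real (card B) - 1) * x $ e p + (\<Sum>k\<in>B. x $ k)
            \<le> real (card B) - 1 + real (card B) * (\<Sum>k\<in>A. 1 - x $ k)"
          using x unfolding slack cardB sumB by (simp add: algebra_simps)
        show "convex (convex hull K)" by (rule convex_convex_hull)
        show "w \<in> convex hull K" if "w \<in> unit_cube" "a \<in> A" "w $ a = 0" for w a
          using that by (intro face[of w "{a}"]) (auto simp: memK A_def)
        show "w \<in> convex hull K" if "w \<in> unit_cube" "w $ e p = 0" "j \<in> B" "w $ j = 0" for w j
          using that by (intro face[of w "{e p, j}"]) (auto simp: memK B_def)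
        show "w \<in> convex hull K" if "w \<in> unit_cube" "\<And>j. j \<in> B \<Longrightarrow> w $ j = 0" for w
          using that by (intro face[of w B]) (auto simp: memK B_def)
      qed
    qed
  qed

  assume q3: "p + 3 \<le> q"
  have "minimal_cover e K ({1..p-1} \<union> ?B)" and "minimal_cover e K ({1..p} \<union> {q})"
    using pq by (auto simp only: min_cover) auto
  then have "multi_cover e K {{1..p-1} \<union> ?B, {1..p} \<union> {q}}"
    using pq p1 by (intro multi_cover_pair) (auto simp: minimal_cover_def)
  then show "is_MCI e K
      (\<lambda>i. if i < p then int q - int p
           else if i = p then int q - int p - 1
           else if i \<le> q then 1 else 0)
      (int p * (int q - int p) - 1)"
    unfolding is_MCI_def using MCI_of_pair[OF p1 q3] by blast
qed

end
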